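(* Let $\Sigma=\{0,1\}^{\mathbb{N}}$ and let $\sigma:\Sigma\to\Sigma$ be the one-sided shift map $\sigma(\alpha_1\alpha_2\alpha_3\dots)=\alpha_2\alpha_3\dots$. Then every point of $\Sigma$ is a DC1-point of $\sigma$.
   Context: $\Sigma$ is the space of all infinite sequences $\alpha_1\alpha_2\alpha_3\dots$ of $0$'s and $1$'s, equipped with the metric $d(x,y)=\frac1i$ for $x\ne y$, where $i\in\{1,2,\dots\}$ is the first position at which $x$ and $y$ differ, and $d(x,x)=0$. Let $(X,d)$ be a compact metric space and $f:X\to X$ continuous; $f^n$ denotes the $n$-th iterate and $B(x_0,\varepsilon)$ the open ball of radius $\varepsilon$ about $x_0$. For $x,y\in X$, $t\in\mathbb{R}$ and $n\ge 1$ let $\xi(x,y,t,n)$ be the number of indices $i\in\{0,1,\dots,n-1\}$ with $d(f^i(x),f^i(y))<t$, and put $$\Psi^n_{xy}(f,t)=\tfrac1n\,\xi(x,y,t,n),\qquad \Psi_{xy}(f,t)=\liminf_{n\to\infty}\Psi^n_{xy}(f,t),\qquad \Psi^*_{xy}(f,t)=\limsup_{n\to\infty}\Psi^n_{xy}(f,t).$$ A pair $x,y$ is a DC1-scrambled pair of $f$ if $\Psi^*_{xy}(f,t)=1$ for all $t>0$ and $\Psi_{xy}(f,t)=0$ for some $t>0$. A set $S\subseteq X$ is DC1-scrambled for $f$ if every pair of distinct points of $S$ is a DC1-scrambled pair of $f$. A point $x_0\in X$ is a DC1-point of $f$ if for every $\varepsilon>0$ there exist an uncountable DC1-scrambled set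 $S_\varepsilon$ for $f$, a positive integer $n(\varepsilon)$, and a closed set $A_\varepsilon\supseteq S_\varepsilon$ such that $A_\varepsilon\subseteq f^{n(\varepsilon)}(A_\varepsilon)\subseteq B(x_0,\varepsilon)$. *)

theory Defs
  imports "HOL-Analysis.Analysis"
begin

locale compact_dynamical_system = Metric_space M d
  for M :: "'a set" and d :: "'a \<Rightarrow> 'a \<Rightarrow> real" +
  fixes f :: "'a \<Rightarrow> 'a"
  assumes compact: "compact_space mtopology"
    and continuous: "continuous_map mtopology mtopology f"
begin

definition xi :: "'a \<Rightarrow> 'a \<Rightarrow> real \<Rightarrow> nat \<Rightarrow> nat" where
  "xi x y t n = card {i \<in> {0..<n}. d ((f ^^ i) x) ((f ^^ i) y) < t}"

text \<open>Only the values for \<open>n \<ge> 1\<close> are meaningful; the junk value at \<open>n = 0\<close> does not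
  affect the limits below.\<close>

definition Psi_n :: "'a \<Rightarrow> 'a \<Rightarrow> real \<Rightarrow> nat \<Rightarrow> real" where
  "Psi_n x y t n = real (xi x y t n) / real n"

definition Psi_lower :: "'a \<Rightarrow> 'a \<Rightarrow> real \<Rightarrow> ereal" where
  "Psi_lower x y t = liminf (\<lambda>n. ereal (Psi_n x y t n))"

definition Psi_upper :: "'a \<Rightarrow> 'a \<Rightarrow> real \<Rightarrow> ereal" where
  "Psi_upper x y t = limsup (\<lambda>n. ereal (Psi_n x y t n))"

definition DC1_pair :: "'a \<Rightarrow> 'a \<Rightarrow> bool" where
  "DC1_pair x y \<longleftrightarrow> (\<forall>t>0. Psi_upper x y t = 1) \<and> (\<exists>t>0. Psi_lower x y t = 0)"

definition DC1_scrambled :: "'a set \<Rightarrow> bool" where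
  "DC1_scrambled S \<longleftrightarrow> S \<subseteq> M \<and> (\<forall>x\<in>S. \<forall>y\<in>S. x \<noteq> y \<longrightarrow> DC1_pair x y)"

definition DC1_point :: "'a \<Rightarrow> bool" where
  "DC1_point x0 \<longleftrightarrow> x0 \<in> M \<and>
     (\<forall>\<epsilon>>0. \<exists>S n A. uncountable S \<and> DC1_scrambled S \<and> 0 < n \<and>
        closedin mtopology A \<and> S \<subseteq> A \<and>
        A \<subseteq> (f ^^ n) ` A \<and> (f ^^ n) ` A \<subseteq> mball x0 \<epsilon>)"

end

text \<open>The sequence \<open>\<alpha>\<^sub>1\<alpha>\<^sub>2\<alpha>\<^sub>3\<dots>\<close> is the function \<open>x\<close> with \<open>x i = \<alpha>\<^bsub>i+1\<^esub>\<close>, so the first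
  position of difference, counted from 1, is one more than the least differing index.
  \<open>seq_dist\<close> is not the \<open>dist\<close> that the library puts on function spaces.\<close>

type_synonym bseq = "nat \<Rightarrow> bool"

definition seq_dist :: "bseq \<Rightarrow> bseq \<Rightarrow> real" where
  "seq_dist x y = (if x = y then 0 else 1 / real (Suc (LEAST i. x i \<noteq> y i)))"

definition shift :: "bseq \<Rightarrow> bseq" where
  "shift x = (\<lambda>i. x (Suc i))"

lemma seq_dist_less_iff:
  "seq_dist x y < 1 / real (Suc n) \<longleftrightarrow> (\<forall>i\<le>n. x i = y i)"
proof (cases "x = y")
  case False
  define k where "k = (LEAST i. x i \<noteq> y i)"
  have k: "x k \<noteq> y k"
    unfolding k_def by (rule LeastI_ex) (use False in \<open>simp add: fun_eq_iff\<close>)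
  have less: "x i = y i" if "i < k" for i
    using not_less_Least[OF that[unfolded k_def]] by simp
  have dist: "seq_dist x y = 1 / real (Suc k)"
    using False by (simp add: seq_dist_def k_def)
  have "seq_dist x y < 1 / real (Suc n) \<longleftrightarrow> n < k"
    by (simp add: dist field_simps)
  also have "\<dots> \<longleftrightarrow> (\<forall>i\<le>n. x i = y i)"
    using k less by (metis le_less_trans not_le)
  finally show ?thesis .
qed (simp add: seq_dist_def)

interpretation seq: Metric_space UNIV seq_dist
proof
  fix x y z :: bseq
  show "0 \<le> seq_dist x y" by (simp add: seq_dist_def)
  show "seq_dist x y = seq_dist y x" by (simp add: seq_dist_def eq_commute)
  show "seq_dist x y = 0 \<longleftrightarrow> x = y" by (simp add: seq_dist_def)
  show "seq_dist x z \<le> seq_dist x y + seq_dist y z"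
  proof (cases "x = z")
    case False
    define k where "k = (LEAST i. x i \<noteq> z i)"
    have k: "x k \<noteq> z k"
      unfolding k_def by (rule LeastI_ex) (use False in \<open>simp add: fun_eq_iff\<close>)
    then have "x k \<noteq> y k \<or> y k \<noteq> z k" by auto
    then have "\<not> seq_dist x y < 1 / real (Suc k) \<or> \<not> seq_dist y z < 1 / real (Suc k)"
      unfolding seq_dist_less_iff by blast
    moreover have "seq_dist x z = 1 / real (Suc k)"
      using False by (simp add: seq_dist_def k_def)
    moreover have "0 \<le> seq_dist x y" "0 \<le> seq_dist y z"
      by (simp_all add: seq_dist_def)
    ultimately show ?thesis by linarith
  qed (simp add: seq_dist_def)
qed

lemma seq_compact: "compact_space seq.mtopology"
proof -
  let ?P = "product_topology (\<lambda>_. discrete_topology UNIV) UNIV :: bseq topology"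
  have "continuous_map ?P seq.mtopology (\<lambda>x. x)"
    unfolding seq.continuous_map_to_metric
  proof (intro ballI allI impI)
    fix x :: bseq and \<epsilon> :: real
    assume "0 < \<epsilon>"
    then obtain n where n: "1 / real (Suc n) < \<epsilon>"
      using nat_approx_posE by blast
    define U where "U = (\<Pi>\<^sub>E i\<in>UNIV. if i \<le> n then {x i} else UNIV)"
    have "{i. (if i \<le> n then {x i} else UNIV) \<noteq> (UNIV :: bool set)} \<subseteq> {..n}"
      by auto
    then have "finite {i. (if i \<le> n then {x i} else UNIV) \<noteq> (UNIV :: bool set)}"
      using finite_subset by blast
    then have "openin ?P U"
      unfolding U_def by (intro product_topology_basis) auto
    moreover have U: "y \<in> U \<longleftrightarrow> (\<forall>i\<le>n. x i = y i)" for y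
      by (auto simp: U_def PiE_iff)
    moreover have "x \<in> U" by (simp add: U)
    moreover have "y \<in> seq.mball x \<epsilon>" if "y \<in> U" for y
    proof -
      have "\<forall>i\<le>n. x i = y i"
        using that by (simp add: U)
      then show ?thesis
        using n seq_dist_less_iff[of x y n] by simp
    qed
    ultimately show "\<exists>U. openin ?P U \<and> x \<in> U \<and> (\<forall>y\<in>U. y \<in> seq.mball x \<epsilon>)"
      by blast
  qed
  moreover have "compact_space ?P"
    by (simp add: compact_space_product_topology compact_space_discrete_topology)
  ultimately show ?thesis
    using image_compactin[of ?P UNIV seq.mtopology "\<lambda>x. x"]
    by (simp add: compact_space_def)
qed

lemma shift_continuous: "continuous_map seq.mtopology seq.mtopology shift"
  unfolding seq.continuous_map_to_metric
proof (intro ballI allI impI)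
  fix x :: bseq and \<epsilon> :: real
  assume "0 < \<epsilon>"
  then obtain n where n: "1 / real (Suc n) < \<epsilon>"
    using nat_approx_posE by blast
  have "shift y \<in> seq.mball (shift x) \<epsilon>"
    if "y \<in> seq.mball x (1 / real (Suc (Suc n)))" for y
  proof -
    have "\<forall>i\<le>Suc n. x i = y i"
      using that seq_dist_less_iff[of x y "Suc n"] by simp
    then have "\<forall>i\<le>n. shift x i = shift y i"
      by (simp add: shift_def)
    then show ?thesis
      using n seq_dist_less_iff[of "shift x" "shift y" n] by simp
  qed
  moreover have "x \<in> seq.mball x (1 / real (Suc (Suc n)))" by simp
  ultimately show "\<exists>U. openin seq.mtopology U \<and> x \<in> U \<and>
      (\<forall>y\<in>U. shift y \<in> seq.mball (shift x) \<epsilon>)"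
    using seq.openin_mball by blast
qed

interpretation full_shift: compact_dynamical_system UNIV seq_dist shift
  by unfold_locales (fact seq_compact shift_continuous)+

end

theory Submission
  imports Defs
begin

text \<open>Fix a prefix of \<open>x\<close> of length \<open>N + 1\<close> and let \<open>A\<close> be the set of all concatenations of blocks
  of length \<open>L = N + 2\<close> that consist of this prefix and one free digit. Then \<open>\<sigma>\<^sup>L(A) = A\<close>, and \<open>A\<close>
  lies in a small ball around \<open>x\<close>. A sequence \<open>s\<close> is encoded in the free digits: those with block
  number in \<open>[k!, (k+1)!)\<close> all carry a single digit, which is \<open>0\<close> for infinitely many \<open>k\<close> and
  \<open>s m\<close> for infinitely many \<open>k\<close>, for each \<open>m\<close>. Since \<open>k! / (k+1)! \<rightarrow> 0\<close>, two different codes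
  agree on almost all of infinitely many initial segments, and on infinitely many others almost
  every window of length \<open>L\<close> contains a difference.\<close>

section \<open>Criteria for the limits of the frequencies\<close>

context compact_dynamical_system
begin

lemma xi_le: "xi x y t n \<le> n"
  unfolding xi_def by (rule order_trans[OF card_mono[of "{0..<n}"]]) auto

text \<open>The ratios never exceed 1, so lower bounds at arbitrarily large \<open>n\<close> already
  decide the upper limit.\<close>

lemma Psi_upper_eq_1I:
  assumes "\<And>e N. 0 < e \<Longrightarrow> \<exists>n>N. (1 - e) * real n \<le> real (xi x y t n)"
  shows "Psi_upper x y t = 1"
proof (rule antisym)
  \<comment> \<open>At \<open>n = 0\<close> the quotient is 0, by the convention for division by
    zero.\<close>
  have "Psi_n x y t n \<le> 1" for n
    using xi_le[of x y t n] by (cases "n = 0") (simp_all add: Psi_n_def)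
  then show "Psi_upper x y t \<le> 1"
    unfolding Psi_upper_def by (intro Limsup_bounded always_eventually) auto
  show "1 \<le> Psi_upper x y t"
  proof (rule ereal_le_epsilon2)
    fix e :: real
    assume "0 < e"
    have "ereal (1 - e) \<le> Psi_upper x y t"
      unfolding Psi_upper_def limsup_INF_SUP
    proof (rule INF_greatest)
      fix N
      obtain n where "N < n" "(1 - e) * real n \<le> real (xi x y t n)"
        using assms \<open>0 < e\<close> by blast
      then have "1 - e \<le> Psi_n x y t n"
        by (simp add: Psi_n_def pos_le_divide_eq)
      with \<open>N < n\<close> show "ereal (1 - e) \<le> (SUP n\<in>{N..}. ereal (Psi_n x y t n))"
        by (intro SUP_upper2[of n]) auto
    qed
    then show "1 \<le> Psi_upper x y t + ereal e"
      by (cases "Psi_upper x y t") auto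
  qed
qed

lemma Psi_lower_eq_0I:
  assumes "\<And>e N. 0 < e \<Longrightarrow> \<exists>n>N. real (xi x y t n) \<le> e * real n"
  shows "Psi_lower x y t = 0"
proof (rule antisym)
  show "0 \<le> Psi_lower x y t"
    unfolding Psi_lower_def by (intro Liminf_bounded always_eventually) (auto simp: Psi_n_def)
  show "Psi_lower x y t \<le> 0"
  proof (rule ereal_le_epsilon2)
    fix e :: real
    assume "0 < e"
    have "Psi_lower x y t \<le> ereal e"
      unfolding Psi_lower_def liminf_SUP_INF
    proof (rule SUP_least)
      fix N
      obtain n where "N < n" "real (xi x y t n) \<le> e * real n"
        using assms \<open>0 < e\<close> by blast
      then have "Psi_n x y t n \<le> e"
        by (simp add: Psi_n_def pos_divide_le_eq)
      with \<open>N < n\<close> show "(INF n\<in>{N..}. ereal (Psi_n x y t n)) \<le> ereal e"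
        by (intro INF_lower2[of n]) auto
    qed
    then show "Psi_lower x y t \<le> 0 + ereal e"
      by simp
  qed
qed

end

section \<open>Counting close iterates of the shift\<close>

lemma funpow_shift: "(shift ^^ n) x = (\<lambda>i. x (i + n))"
  by (induction n) (auto simp: shift_def)

text \<open>The iterates at \<open>i\<close> are closer than \<open>1 / real (Suc m)\<close> iff the
  windows of \<open>m + 1\<close> digits from \<open>i\<close> on agree. The last \<open>m\<close>
  windows starting before \<open>b\<close> reach past the known agreement, hence the loss of
  \<open>m\<close>.\<close>

lemma xi_shift_ge:
  assumes "\<And>i. a \<le> i \<Longrightarrow> i < b \<Longrightarrow> x i = y i" and "1 / real (Suc m) \<le> t"
  shows "b - a - m \<le> full_shift.xi x y t b"
proof -
  have "{a..<b - m} \<subseteq> {i \<in> {0..<b}. seq_dist ((shift ^^ i) x) ((shift ^^ i) y) < t}"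
  proof
    fix i
    assume "i \<in> {a..<b - m}"
    then have "seq_dist ((shift ^^ i) x) ((shift ^^ i) y) < 1 / real (Suc m)"
      using assms(1) by (auto simp only: seq_dist_less_iff funpow_shift) auto
    with assms(2) \<open>i \<in> {a..<b - m}\<close>
    show "i \<in> {i \<in> {0..<b}. seq_dist ((shift ^^ i) x) ((shift ^^ i) y) < t}"
      by auto
  qed
  from card_mono[OF _ this] show ?thesis
    by (simp add: full_shift.xi_def diff_commute)
qed

lemma xi_shift_le:
  assumes "\<And>i. a \<le> i \<Longrightarrow> i < b \<Longrightarrow> \<exists>j\<le>m. x (i + j) \<noteq> y (i + j)"
  shows "full_shift.xi x y (1 / real (Suc m)) b \<le> a"
proof -
  have "{i \<in> {0..<b}. seq_dist ((shift ^^ i) x) ((shift ^^ i) y) < 1 / real (Suc m)} \<subseteq> {..<a}"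
  proof (clarsimp simp only: seq_dist_less_iff funpow_shift lessThan_iff atLeastLessThan_iff)
    fix i
    assume "i < b" "\<forall>j\<le>m. x (j + i) = y (j + i)"
    then show "i < a"
      using assms[of i] by (force simp: add.commute)
  qed
  from card_mono[OF _ this] show ?thesis
    by (simp add: full_shift.xi_def)
qed

text \<open>With \<open>a = L * fact k\<close> and \<open>b = L * fact (Suc k) = Suc k * a\<close>,
  the indices below \<open>a\<close> are only the fraction \<open>1 / (k + 1)\<close> of those below
  \<open>b\<close>. So the behaviour between \<open>a\<close> and \<open>b\<close> fixes the ratio
  at \<open>b\<close> up to a vanishing error.\<close>

lemma DC1_pair_shiftI:
  assumes "0 < L"
    and agree: "\<And>j. \<exists>k\<ge>j. \<forall>i. L * fact k \<le> i \<longrightarrow> i < L * fact (Suc k) \<longrightarrow> x i = y i"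
    and differ: "\<And>j. \<exists>k\<ge>j. \<forall>i. L * fact k \<le> i \<longrightarrow> i < L * fact (Suc k) \<longrightarrow>
      (\<exists>l\<le>m. x (i + l) \<noteq> y (i + l))"
  shows "full_shift.DC1_pair x y"
  unfolding full_shift.DC1_pair_def
proof (intro conjI allI impI exI)
  have b_gt: "k < L * fact (Suc k)" for k
  proof -
    have "k < Suc k" by simp
    also have "\<dots> \<le> fact (Suc k)" by (rule fact_ge_self)
    also have "\<dots> \<le> L * fact (Suc k)" using \<open>0 < L\<close> by simp
    finally show ?thesis .
  qed
  {
    fix t :: real
    assume "0 < t"
    then obtain m where m: "1 / real (Suc m) < t"
      using nat_approx_posE by blast
    show "full_shift.Psi_upper x y t = 1"
    proof (rule full_shift.Psi_upper_eq_1I)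
      fix e :: real and N
      assume "0 < e"
      \<comment> \<open>For \<open>k \<ge> j\<close> this gives
        \<open>1 + m \<le> e * (k + 1)\<close>, so the error \<open>a + m \<le> (1 + m) * a\<close>
        is at most \<open>e * b\<close>.\<close>
      obtain j where j: "(1 + real m) / e < real j"
        using reals_Archimedean2 by blast
      obtain k where k: "max N j \<le> k"
        and eq: "\<forall>i. L * fact k \<le> i \<longrightarrow> i < L * fact (Suc k) \<longrightarrow> x i = y i"
        using agree by blast
      define a where "a = L * fact k"
      define b where "b = L * fact (Suc k)"
      have b: "b = Suc k * a" by (simp add: a_def b_def algebra_simps)
      have "k < b" using b_gt by (simp add: b_def)
      have ek: "1 + real m \<le> e * real (Suc k)"
      proof -
        have "1 + real m < e * real j"
          using j \<open>0 < e\<close> by (simp add: divide_less_eq mult.commute)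
        also have "\<dots> \<le> e * real (Suc k)"
          using k \<open>0 < e\<close> by simp
        finally show ?thesis by simp
      qed
      have "0 < a" using \<open>0 < L\<close> by (simp add: a_def)
      then have "real a + real m \<le> (1 + real m) * real a"
        using mult_left_mono[of 1 "real a" "real m"] by (simp add: algebra_simps)
      also have "\<dots> \<le> (e * real (Suc k)) * real a"
        using ek by (intro mult_right_mono) auto
      finally have "real a + real m \<le> e * real b"
        by (simp only: b of_nat_mult mult.assoc)
      moreover have "b - a - m \<le> full_shift.xi x y t b"
        using eq m by (intro xi_shift_ge) (auto simp: a_def b_def)
      then have "real b - real a - real m \<le> real (full_shift.xi x y t b)"
        by linarith
      ultimately have "(1 - e) * real b \<le> real (full_shift.xi x y t b)"
        by (simp add: left_diff_distrib)
      moreover have "N < b" using \<open>k < b\<close> k by simp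
      ultimately show "\<exists>n>N. (1 - e) * real n \<le> real (full_shift.xi x y t n)"
        by blast
    qed
  next
    \<comment> \<open>The witness for \<open>t\<close> uses the \<open>m\<close> of the hypothesis
      \<open>differ\<close>, not the one obtained from \<open>t\<close> above.\<close>
    show "0 < 1 / real (Suc m)" by simp
  next
    show "full_shift.Psi_lower x y (1 / real (Suc m)) = 0"
    proof (rule full_shift.Psi_lower_eq_0I)
      fix e :: real and N
      assume "0 < e"
      obtain j where j: "1 / e < real j"
        using reals_Archimedean2 by blast
      obtain k where k: "max N j \<le> k"
        and neq: "\<forall>i. L * fact k \<le> i \<longrightarrow> i < L * fact (Suc k) \<longrightarrow> (\<exists>l\<le>m. x (i + l) \<noteq> y (i + l))"
        using differ by blast
      define a where "a = L * fact k"
      define b where "b = L * fact (Suc k)"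
      have b: "b = Suc k * a" by (simp add: a_def b_def algebra_simps)
      have "1 < e * real j"
        using j \<open>0 < e\<close> by (simp add: divide_less_eq mult.commute)
      also have "\<dots> \<le> e * real (Suc k)"
        using k \<open>0 < e\<close> by simp
      finally have "1 * real a \<le> (e * real (Suc k)) * real a"
        by (intro mult_right_mono) auto
      then have "real a \<le> e * real b"
        by (simp only: b of_nat_mult mult.assoc mult_1)
      moreover have "full_shift.xi x y (1 / real (Suc m)) b \<le> a"
        using neq by (intro xi_shift_le) (auto simp: a_def b_def)
      ultimately have "real (full_shift.xi x y (1 / real (Suc m)) b) \<le> e * real b"
        by linarith
      moreover have "N < b" using b_gt[of k] k by (simp add: b_def)
      ultimately show "\<exists>n>N. real (full_shift.xi x y (1 / real (Suc m)) n) \<le> e * real n"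
        by blast
    qed
  }
qed

section \<open>Coding sequences in the free digits\<close>

definition level :: "nat \<Rightarrow> nat" where
  "level q = (LEAST k. q < fact (Suc k))"

text \<open>Monotonicity of the factorial rules out any smaller index. For \<open>k = 0\<close> the
  interval is empty.\<close>

lemma level_eq: "level q = k" if "fact k \<le> q" "q < fact (Suc k)"
  unfolding level_def
proof (rule Least_equality)
  fix j
  assume "q < fact (Suc j)"
  show "k \<le> j"
  proof (rule ccontr)
    assume "\<not> k \<le> j"
    then have "fact (Suc j) \<le> (fact k :: nat)"
      by (intro fact_mono) simp
    with that(1) \<open>q < fact (Suc j)\<close> show False by linarith
  qed
qed (fact that(2))

text \<open>The second component of \<open>prod_decode k\<close> is a mere counter: it makes each
  value of the first recur for infinitely many \<open>k\<close>.\<close>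

definition level_digit :: "bseq \<Rightarrow> nat \<Rightarrow> bool" where
  "level_digit s k = (case fst (prod_decode k) of 0 \<Rightarrow> False | Suc m \<Rightarrow> s m)"

definition code :: "nat \<Rightarrow> bseq \<Rightarrow> bseq \<Rightarrow> bseq" where
  "code N w s i = (if i mod (N + 2) \<le> N then w (i mod (N + 2))
     else level_digit s (level (i div (N + 2))))"

lemma level_div:
  assumes "0 < L" "L * fact k \<le> i" "i < L * fact (Suc k)"
  shows "level (i div L) = k"
proof (rule level_eq)
  show "fact k \<le> i div L"
    using assms(1,2) by (simp add: less_eq_div_iff_mult_less_eq mult.commute)
  show "i div L < fact (Suc k)"
    using assms(3) by (intro less_mult_imp_div_less) (simp only: mult.commute)
qed

lemma DC1_pair_code:
  assumes "s \<noteq> s'"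
  shows "full_shift.DC1_pair (code N w s) (code N w s')"
proof (rule DC1_pair_shiftI[of "N + 2" _ _ "N + 1"])
  fix j
  \<comment> \<open>On this level both codes carry \<open>False\<close> in every free digit.\<close>
  let ?k = "prod_encode (0, j)"
  have "code N w s i = code N w s' i"
    if "(N + 2) * fact ?k \<le> i" "i < (N + 2) * fact (Suc ?k)" for i
    using level_div[OF _ that] by (simp add: code_def level_digit_def)
  then show "\<exists>k\<ge>j. \<forall>i. (N + 2) * fact k \<le> i \<longrightarrow> i < (N + 2) * fact (Suc k) \<longrightarrow>
      code N w s i = code N w s' i"
    using le_prod_encode_2 by blast
next
  fix j
  obtain p where p: "s p \<noteq> s' p"
    using assms by blast
  \<comment> \<open>On this level the free digits are \<open>s p\<close> and
    \<open>s' p\<close>.\<close>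
  let ?k = "prod_encode (Suc p, j)"
  have "\<exists>l\<le>N + 1. code N w s (i + l) \<noteq> code N w s' (i + l)"
    if "(N + 2) * fact ?k \<le> i" "i < (N + 2) * fact (Suc ?k)" for i
  proof (intro exI conjI)
    \<comment> \<open>The distance from \<open>i\<close> to the last digit of its block, which is
      the free one; staying in the block keeps the level.\<close>
    define l where "l = N + 1 - i mod (N + 2)"
    have "i mod (N + 2) < N + 2" by simp
    then have "i + l = N + 1 + (N + 2) * (i div (N + 2))"
      using mult_div_mod_eq[of "N + 2" i] unfolding l_def by linarith
    then have "(i + l) mod (N + 2) = N + 1" "(i + l) div (N + 2) = i div (N + 2)"
      by (simp_all only: mod_mult_self2 div_mult_self2) simp_all
    then show "code N w s (i + l) \<noteq> code N w s' (i + l)"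
      using level_div[OF _ that] p by (simp add: code_def level_digit_def)
    show "l \<le> N + 1" by (simp add: l_def)
  qed
  then show "\<exists>k\<ge>j. \<forall>i. (N + 2) * fact k \<le> i \<longrightarrow> i < (N + 2) * fact (Suc k) \<longrightarrow>
      (\<exists>l\<le>N + 1. code N w s (i + l) \<noteq> code N w s' (i + l))"
    using le_prod_encode_2 by blast
qed simp

text \<open>All ratios with \<open>n \<ge> 1\<close> equal 1, hence so does their lower
  limit.\<close>

lemma not_DC1_pair_refl: "\<not> full_shift.DC1_pair x x"
proof -
  have "full_shift.Psi_lower x x t \<noteq> 0" if "0 < t" for t
  proof -
    have "full_shift.Psi_n x x t n = 1" if "0 < n" for n
      using that \<open>0 < t\<close> by (simp add: full_shift.Psi_n_def full_shift.xi_def)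
    then have "\<forall>\<^sub>F n in sequentially. ereal (full_shift.Psi_n x x t n) = 1"
      by (intro eventually_sequentiallyI[of 1]) auto
    then have "full_shift.Psi_lower x x t = liminf (\<lambda>n. 1)"
      unfolding full_shift.Psi_lower_def by (rule Liminf_eq)
    then show ?thesis by (simp add: Liminf_const)
  qed
  then show ?thesis by (auto simp: full_shift.DC1_pair_def)
qed

lemma uncountable_bseq: "uncountable (UNIV :: bseq set)"
proof
  assume "countable (UNIV :: bseq set)"
  then obtain g :: "nat \<Rightarrow> bseq" where "surj g"
    using uncountable_def by blast
  then obtain n where "g n = (\<lambda>i. \<not> g i i)"
    by (metis surjD)
  then show False
    by (metis (full_types))
qed

section \<open>The closed invariant set \<open>A\<close>\<close>

definition prefixed_blocks :: "nat \<Rightarrow> bseq \<Rightarrow> bseq set" where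
  "prefixed_blocks N w = {y. \<forall>i. i mod (N + 2) \<le> N \<longrightarrow> y i = w (i mod (N + 2))}"

text \<open>Non-membership shows at a single coordinate \<open>i\<close>, and the ball of radius
  \<open>1 / real (Suc i)\<close> fixes that coordinate.\<close>

lemma closedin_prefixed_blocks: "closedin seq.mtopology (prefixed_blocks N w)"
  unfolding seq.closedin_metric
proof (intro conjI allI impI)
  fix y
  assume "y \<in> UNIV - prefixed_blocks N w"
  then obtain i where i: "i mod (N + 2) \<le> N" "y i \<noteq> w (i mod (N + 2))"
    by (auto simp: prefixed_blocks_def)
  have "disjnt (prefixed_blocks N w) (seq.mball y (1 / real (Suc i)))"
    using i by (auto simp: disjnt_iff prefixed_blocks_def seq.in_mball seq_dist_less_iff
        simp del: of_nat_Suc)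
  then show "\<exists>r>0. disjnt (prefixed_blocks N w) (seq.mball y r)"
    by (intro exI[of _ "1 / real (Suc i)"]) simp
qed simp

lemma funpow_shift_prefixed_blocks:
  "(shift ^^ (N + 2)) ` prefixed_blocks N w = prefixed_blocks N w"
proof
  show "(shift ^^ (N + 2)) ` prefixed_blocks N w \<subseteq> prefixed_blocks N w"
    by (auto simp only: prefixed_blocks_def funpow_shift mem_Collect_eq mod_add_self2)
  show "prefixed_blocks N w \<subseteq> (shift ^^ (N + 2)) ` prefixed_blocks N w"
  proof
    fix y
    assume y: "y \<in> prefixed_blocks N w"
    \<comment> \<open>A preimage of \<open>y\<close>: its own first block, which has the right
      prefix, put in front of it.\<close>
    define z where "z i = (if i < N + 2 then y i else y (i - (N + 2)))" for i
    have "z \<in> prefixed_blocks N w"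
      using y by (auto simp: prefixed_blocks_def z_def le_mod_geq)
    moreover have "(shift ^^ (N + 2)) z = y"
      by (simp only: funpow_shift) (simp add: z_def)
    ultimately show "y \<in> (shift ^^ (N + 2)) ` prefixed_blocks N w"
      by (metis image_eqI)
  qed
qed

lemma prefixed_blocks_subset_mball:
  assumes "1 / real (Suc N) < \<epsilon>"
  shows "prefixed_blocks N w \<subseteq> seq.mball w \<epsilon>"
proof
  fix y
  assume "y \<in> prefixed_blocks N w"
  then have "\<forall>i\<le>N. w i = y i"
    by (auto simp: prefixed_blocks_def dest: spec)
  then have "seq_dist w y < 1 / real (Suc N)"
    by (simp only: seq_dist_less_iff)
  with assms show "y \<in> seq.mball w \<epsilon>"
    by simp
qed

theorem lemma1:
  fixes x :: "nat \<Rightarrow> bool"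
  shows "compact_dynamical_system.DC1_point UNIV seq_dist shift x"
  unfolding full_shift.DC1_point_def
proof (intro conjI allI impI)
  fix \<epsilon> :: real
  assume "0 < \<epsilon>"
  then obtain N where N: "1 / real (Suc N) < \<epsilon>"
    using nat_approx_posE by blast
  \<comment> \<open>Distinct sequences with equal codes would make a point a DC1 pair with
    itself.\<close>
  have "inj (code N x)"
    using DC1_pair_code not_DC1_pair_refl by (metis injI)
  then have "uncountable (range (code N x))"
    using countable_image_inj_eq uncountable_bseq by blast
  moreover have "full_shift.DC1_scrambled (range (code N x))"
    unfolding full_shift.DC1_scrambled_def by (clarsimp, rule DC1_pair_code) auto
  moreover have "range (code N x) \<subseteq> prefixed_blocks N x"
    by (auto simp: code_def prefixed_blocks_def)
  \<comment> \<open>As the shift by one block maps \<open>A\<close> onto itself, it remains for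
    \<open>A\<close> to lie in the ball.\<close>
  ultimately show "\<exists>S n A. uncountable S \<and> full_shift.DC1_scrambled S \<and> 0 < n \<and>
      closedin seq.mtopology A \<and> S \<subseteq> A \<and>
      A \<subseteq> (shift ^^ n) ` A \<and> (shift ^^ n) ` A \<subseteq> seq.mball x \<epsilon>"
    using closedin_prefixed_blocks funpow_shift_prefixed_blocks
      prefixed_blocks_subset_mball[OF N]
    by (intro exI[of _ "range (code N x)"] exI[of _ "N + 2"] exI[of _ "prefixed_blocks N x"])
      (simp only: order_refl, simp)
qed simp

end
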